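(* Let $a$ and $b$ be positive integers with $b\geq\max\{a,3\}$, and let $G$ be a graph of order $n$ with $n\geq\max\{a+2,7\}$. If the minimum degree satisfies $\delta(G)\geq a+1$ and the number of edges satisfies $$e(G)\geq\binom{n-1}{2}+\frac{a+2}{2},$$ then $G$ is a fractional $[a,b]$-deleted graph.
   Context: All graphs are finite, undirected, without loops or multiple edges. For a graph $G$ and vertex $v$, $E_G(v)$ denotes the set of edges incident with $v$. For positive integers $a\leq b$, a fractional $[a,b]$-factor of $G$ is given by a function $h:E(G)\to[0,1]$ such that $a\leq\sum_{e\in E_G(v)}h(e)\leq b$ for every $v\in V(G)$ (the factor being the spanning subgraph with edge set $\{e: h(e)>0\}$). $G$ is called a fractional $[a,b]$-deleted graph if for every edge $e\in E(G)$, the graph $G-e$ has a fractional $[a,b]$-factor. $e(G)$ denotes the number of edges of $G$ and $\delta(G)$ its minimum degree. *)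

theory Defs
  imports Complex_Main "HOL-Library.Ramsey"
begin

text \<open>A finite simple graph is given by its vertex set \<open>V\<close> and its set \<open>E\<close> of edges, an edge being
  a two-element subset of \<open>V\<close>.\<close>

definition simple_graph :: "'a set \<Rightarrow> 'a set set \<Rightarrow> bool" where
  "simple_graph V E \<longleftrightarrow> finite V \<and> E \<subseteq> nsets V 2"

definition incident_edges :: "'a set set \<Rightarrow> 'a \<Rightarrow> 'a set set" where
  "incident_edges E v = {e \<in> E. v \<in> e}"

definition degree :: "'a set set \<Rightarrow> 'a \<Rightarrow> nat" where
  "degree E v = card (incident_edges E v)"

text \<open>Meaningful only for finite nonempty \<open>V\<close>.\<close>

definition min_degree :: "'a set \<Rightarrow> 'a set set \<Rightarrow> nat" where
  "min_degree V E = Min (degree E ` V)"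

text \<open>\<open>F\<close> is the edge set of the factor, which is a spanning subgraph, so its vertex set is \<open>V\<close>.
  The values of \<open>h\<close> outside \<open>E\<close> are irrelevant.\<close>

definition fractional_factor ::
    "nat \<Rightarrow> nat \<Rightarrow> 'a set \<Rightarrow> 'a set set \<Rightarrow> 'a set set \<Rightarrow> bool" where
  "fractional_factor a b V E F \<longleftrightarrow>
     (\<exists>h :: 'a set \<Rightarrow> real.
        (\<forall>e\<in>E. 0 \<le> h e \<and> h e \<le> 1) \<and>
        (\<forall>v\<in>V. real a \<le> (\<Sum>e\<in>incident_edges E v. h e) \<and>
                (\<Sum>e\<in>incident_edges E v. h e) \<le> real b) \<and>
        F = {e \<in> E. h e > 0})"

definition fractional_deleted_graph :: "nat \<Rightarrow> nat \<Rightarrow> 'a set \<Rightarrow> 'a set set \<Rightarrow> bool" where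
  "fractional_deleted_graph a b V E \<longleftrightarrow> (\<forall>e\<in>E. \<exists>F. fractional_factor a b V (E - {e}) F)"

end

theory Submission
  imports Defs "HOL-Analysis.Function_Topology"
begin

text \<open>Anstee's criterion for fractional factors is obtained by minimising, over all
  \<open>h : E \<rightarrow> [0,1]\<close>, the sum of the squared distances of the weighted degrees to the prescribed
  intervals. Let \<open>y v\<close> be the signed defect of \<open>v\<close> at a minimiser and suppose that
  \<open>c = max \<bar>y\<bar> > 0\<close>. By first-order optimality, with \<open>T = {y = c}\<close> and \<open>S = {y = -c}\<close>, every edge
  meeting \<open>T\<close> but not \<open>S\<close> has weight \<open>1\<close> and every edge meeting \<open>S\<close> but not \<open>T\<close> has weight \<open>0\<close>, so
  that summing weighted degrees over \<open>T\<close> and \<open>S\<close> shows that the pair \<open>S, T\<close> violates the criterion.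

  For the theorem, let \<open>S, T\<close> violate the criterion in \<open>G - e\<close>. The degree condition forces
  \<open>\<bar>S\<bar> \<ge> 2\<close> and \<open>\<bar>T\<bar> > b\<close>, and then the non-edges at \<open>T\<close> outnumber what the edge condition allows.\<close>

section \<open>Degrees and weighted degrees\<close>

definition weighted_degree :: "'a set set \<Rightarrow> ('a set \<Rightarrow> 'b::comm_monoid_add) \<Rightarrow> 'a \<Rightarrow> 'b" where
  "weighted_degree E h v = (\<Sum>e\<in>incident_edges E v. h e)"

definition edges_avoiding :: "'a set set \<Rightarrow> 'a set \<Rightarrow> 'a set set" where
  "edges_avoiding E S = {e \<in> E. e \<inter> S = {}}"

definition complement_edges :: "'a set \<Rightarrow> 'a set set \<Rightarrow> 'a set set" where
  "complement_edges V E = nsets V 2 - E"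

lemma simple_graph_finite_edges:
  assumes "simple_graph V E"
  shows "finite E"
  using assms finite_subset finite_imp_finite_nsets unfolding simple_graph_def by blast

lemma simple_graph_edgeE:
  assumes "simple_graph V E" "e \<in> E"
  obtains u v where "e = {u, v}" "u \<noteq> v" "u \<in> V" "v \<in> V"
  using assms nsets2_E[of e V] unfolding simple_graph_def by blast

lemma simple_graph_subset:
  assumes "simple_graph V E" "F \<subseteq> E"
  shows "simple_graph V F"
  using assms by (auto simp: simple_graph_def)

lemma simple_graph_complement:
  assumes "simple_graph V E"
  shows "simple_graph V (complement_edges V E)"
  using assms by (auto simp: simple_graph_def complement_edges_def)

lemma sum_weighted_degree:
  fixes h :: "'a set \<Rightarrow> 'b::comm_semiring_1"
  assumes "finite T" "finite E"
  shows "(\<Sum>v\<in>T. weighted_degree E h v) = (\<Sum>e\<in>E. of_nat (card (e \<inter> T)) * h e)"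
proof -
  have "(\<Sum>v\<in>T. weighted_degree E h v) = (\<Sum>v\<in>T. \<Sum>e\<in>E. if v \<in> e then h e else 0)"
    unfolding weighted_degree_def incident_edges_def using assms by (simp add: sum.inter_filter)
  also have "\<dots> = (\<Sum>e\<in>E. \<Sum>v\<in>T. if v \<in> e then h e else 0)"
    by (rule sum.swap)
  also have "\<dots> = (\<Sum>e\<in>E. of_nat (card (e \<inter> T)) * h e)"
    using assms by (simp add: sum.If_cases Int_commute)
  finally show ?thesis .
qed

lemma sum_degree:
  assumes "finite T" "finite E"
  shows "(\<Sum>v\<in>T. degree E v) = (\<Sum>e\<in>E. card (e \<inter> T))"
  using sum_weighted_degree[OF assms, of "\<lambda>_. 1::nat"]
  by (simp add: weighted_degree_def degree_def)

lemma sum_degree_le: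
  assumes "simple_graph V E" "finite T"
  shows "(\<Sum>v\<in>T. degree E v) \<le> 2 * card E"
proof -
  have "(\<Sum>v\<in>T. degree E v) = (\<Sum>e\<in>E. card (e \<inter> T))"
    using assms simple_graph_finite_edges by (intro sum_degree) auto
  also have "\<dots> \<le> (\<Sum>e\<in>E. 2)"
  proof (rule sum_mono)
    fix e assume "e \<in> E"
    then have "finite e" "card e = 2"
      using assms unfolding simple_graph_def nsets_def by auto
    then show "card (e \<inter> T) \<le> 2"
      by (metis card_mono inf_le1)
  qed
  finally show ?thesis by simp
qed

lemma degree_le_card:
  assumes "finite E"
  shows "degree E v \<le> card E"
  unfolding degree_def incident_edges_def using assms by (intro card_mono) auto

lemma degree_Un_disjoint:
  assumes "finite E" "finite F" "E \<inter> F = {}"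
  shows "degree (E \<union> F) v = degree E v + degree F v"
proof -
  have "incident_edges (E \<union> F) v = incident_edges E v \<union> incident_edges F v"
    by (auto simp: incident_edges_def)
  then show ?thesis
    unfolding degree_def using assms
    by (simp add: card_Un_disjoint incident_edges_def disjoint_iff)
qed

lemma degree_delete_edge:
  assumes "finite E" "e \<in> E"
  shows "degree E v = degree (E - {e}) v + degree {e} v"
  using degree_Un_disjoint[of "E - {e}" "{e}" v] assms by (simp add: insert_absorb)

lemma degree_nsets_2:
  assumes "finite V" "v \<in> V"
  shows "degree (nsets V 2) v = card V - 1"
proof -
  have "incident_edges (nsets V 2) v = (\<lambda>w. {v, w}) ` (V - {v})"
    using assms(2) by (auto simp: incident_edges_def nsets_def card_2_iff)
  moreover have "inj_on (\<lambda>w. {v, w}) (V - {v})"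
    by (auto simp: inj_on_def doubleton_eq_iff)
  ultimately show ?thesis
    unfolding degree_def using assms by (simp add: card_image)
qed

lemma degree_complement:
  assumes "simple_graph V E" "v \<in> V"
  shows "degree E v + degree (complement_edges V E) v = card V - 1"
proof -
  have "E \<union> complement_edges V E = nsets V 2" "E \<inter> complement_edges V E = {}"
    using assms(1) by (auto simp: simple_graph_def complement_edges_def)
  moreover have "finite E" "finite (complement_edges V E)"
    using assms(1) simple_graph_complement simple_graph_finite_edges by blast+
  ultimately show ?thesis
    using degree_Un_disjoint[of E "complement_edges V E" v] degree_nsets_2[of V v] assms
    by (simp add: simple_graph_def)
qed

lemma card_complement_edges:
  assumes "simple_graph V E"
  shows "card (complement_edges V E) + card E = card V choose 2"
proof -
  have "finite (nsets V 2)" "E \<subseteq> nsets V 2"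
    using assms by (simp_all add: simple_graph_def finite_imp_finite_nsets)
  then have "card (nsets V 2 - E) + card E = card (nsets V 2)"
    by (metis card_Diff_subset card_mono finite_subset le_add_diff_inverse2)
  then show ?thesis
    by (simp add: complement_edges_def card_nsets)
qed

lemma card_mult_card_le_sum_degree_complement:
  assumes "simple_graph V E" "T \<subseteq> V"
  shows "card V * card T
    \<le> (\<Sum>v\<in>T. degree E v) + 2 * card (complement_edges V E) + card T"
proof -
  have finT: "finite T"
    using assms finite_subset by (auto simp: simple_graph_def)
  have "card V * card T = (\<Sum>v\<in>T. card V)"
    by simp
  also have "\<dots> \<le> (\<Sum>v\<in>T. degree E v + degree (complement_edges V E) v + 1)"
  proof (rule sum_mono)
    fix v assume "v \<in> T"
    then show "card V \<le> degree E v + degree (complement_edges V E) v + 1"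
      using degree_complement[OF assms(1), of v] assms(2) by auto
  qed
  also have "\<dots> = (\<Sum>v\<in>T. degree E v) + (\<Sum>v\<in>T. degree (complement_edges V E) v) + card T"
    by (simp only: sum.distrib card_eq_sum)
  also have "\<dots> \<le> (\<Sum>v\<in>T. degree E v) + 2 * card (complement_edges V E) + card T"
    using sum_degree_le[OF simple_graph_complement[OF assms(1)] finT] by simp
  finally show ?thesis .
qed

lemma degree_le_degree_avoiding:
  assumes "simple_graph V E" "finite S" "v \<notin> S"
  shows "degree E v \<le> degree (edges_avoiding E S) v + card S"
proof -
  have finE: "finite E" using assms(1) by (rule simple_graph_finite_edges)
  have "incident_edges E v \<subseteq> incident_edges (edges_avoiding E S) v \<union> (\<lambda>w. {v, w}) ` S"
  proof
    fix e assume e: "e \<in> incident_edges E v"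
    then obtain u w where "e = {u, w}"
      using simple_graph_edgeE[OF assms(1)] unfolding incident_edges_def by blast
    with e assms(3) show "e \<in> incident_edges (edges_avoiding E S) v \<union> (\<lambda>w. {v, w}) ` S"
      unfolding incident_edges_def edges_avoiding_def by (auto simp: insert_commute)
  qed
  then have "degree E v
      \<le> card (incident_edges (edges_avoiding E S) v \<union> (\<lambda>w. {v, w}) ` S)"
    unfolding degree_def using finE assms(2)
    by (intro card_mono) (auto simp: incident_edges_def edges_avoiding_def)
  also have "\<dots> \<le> degree (edges_avoiding E S) v + card ((\<lambda>w. {v, w}) ` S)"
    unfolding degree_def by (rule card_Un_le)
  also have "card ((\<lambda>w. {v, w}) ` S) \<le> card S"
    using assms(2) by (rule card_image_le)
  finally show ?thesis by simp
qed

lemma sum_degree_le_sum_degree_avoiding: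
  assumes "simple_graph V E" "finite S" "S \<inter> T = {}"
  shows "(\<Sum>v\<in>T. degree E v) \<le> (\<Sum>v\<in>T. degree (edges_avoiding E S) v) + card S * card T"
proof -
  have "(\<Sum>v\<in>T. degree E v) \<le> (\<Sum>v\<in>T. degree (edges_avoiding E S) v + card S)"
    using assms by (intro sum_mono degree_le_degree_avoiding) auto
  then show ?thesis
    by (simp add: sum.distrib mult.commute)
qed

section \<open>Defects of edge weightings\<close>

definition defect :: "real \<Rightarrow> real \<Rightarrow> real \<Rightarrow> real" where
  "defect a b d = max a (min b d) - d"

lemma defect_pos_eq:
  assumes "defect a b d > 0"
  shows "d = a - defect a b d"
  using assms by (auto simp: defect_def max_def min_def split: if_splits)

lemma defect_neg_eq:
  assumes "a \<le> b" "defect a b d < 0"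
  shows "d = b - defect a b d"
  using assms by (auto simp: defect_def max_def min_def split: if_splits)

lemma defect_eq_0_iff:
  assumes "a \<le> b"
  shows "defect a b d = 0 \<longleftrightarrow> d \<in> {a..b}"
  using assms by (auto simp: defect_def max_def min_def)

text \<open>The shifted point is compared with the projection of the original point to \<open>[a,b]\<close>.\<close>

lemma defect_shift_le:
  assumes "a \<le> b"
  shows "(defect a b (d + \<epsilon>))\<^sup>2 \<le> (defect a b d)\<^sup>2 - 2 * \<epsilon> * defect a b d + \<epsilon>\<^sup>2"
proof -
  have "\<bar>defect a b (d + \<epsilon>)\<bar> \<le> \<bar>defect a b d - \<epsilon>\<bar>"
    using assms unfolding defect_def by (simp add: max_def min_def abs_if)
  then have "(defect a b (d + \<epsilon>))\<^sup>2 \<le> (defect a b d - \<epsilon>)\<^sup>2"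
    by (simp add: abs_le_square_iff)
  then show ?thesis
    by (simp add: power2_diff algebra_simps)
qed

definition vertex_defect ::
    "('a \<Rightarrow> real) \<Rightarrow> ('a \<Rightarrow> real) \<Rightarrow> 'a set set \<Rightarrow> ('a set \<Rightarrow> real) \<Rightarrow> 'a \<Rightarrow> real" where
  "vertex_defect g f E h v = defect (g v) (f v) (weighted_degree E h v)"

definition total_defect ::
    "('a \<Rightarrow> real) \<Rightarrow> ('a \<Rightarrow> real) \<Rightarrow> 'a set \<Rightarrow> 'a set set \<Rightarrow> ('a set \<Rightarrow> real) \<Rightarrow> real" where
  "total_defect g f V E h = (\<Sum>v\<in>V. (vertex_defect g f E h v)\<^sup>2)"

lemma weighted_degree_fun_upd:
  fixes h :: "'a set \<Rightarrow> 'b::comm_monoid_add"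
  assumes "finite E" "e \<in> E"
  shows "weighted_degree E (h(e := h e + \<epsilon>)) v
    = weighted_degree E h v + (if v \<in> e then \<epsilon> else 0)"
proof -
  have "weighted_degree E (h(e := h e + \<epsilon>)) v
      = (\<Sum>d\<in>incident_edges E v. h d + (if d = e then \<epsilon> else 0))"
    unfolding weighted_degree_def by (intro sum.cong) auto
  also have "\<dots> = weighted_degree E h v + (if v \<in> e then \<epsilon> else 0)"
    using assms by (simp add: weighted_degree_def sum.distrib incident_edges_def)
  finally show ?thesis .
qed

lemma total_defect_fun_upd_le:
  fixes \<epsilon> :: real
  assumes "finite V" "finite E" "e \<in> E" "e \<subseteq> V" "\<And>v. v \<in> V \<Longrightarrow> g v \<le> f v"
  shows "total_defect g f V E (h(e := h e + \<epsilon>))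
    \<le> total_defect g f V E h - 2 * \<epsilon> * (\<Sum>v\<in>e. vertex_defect g f E h v) + card e * \<epsilon>\<^sup>2"
proof -
  let ?y = "vertex_defect g f E h"
  let ?change = "\<lambda>v. - 2 * \<epsilon> * ?y v + \<epsilon>\<^sup>2"
  have "total_defect g f V E (h(e := h e + \<epsilon>))
      \<le> (\<Sum>v\<in>V. (?y v)\<^sup>2 + (if v \<in> e then ?change v else 0))"
    unfolding total_defect_def
  proof (rule sum_mono)
    fix v assume "v \<in> V"
    then show "(vertex_defect g f E (h(e := h e + \<epsilon>)) v)\<^sup>2
        \<le> (?y v)\<^sup>2 + (if v \<in> e then ?change v else 0)"
      using defect_shift_le[OF assms(5), of v "weighted_degree E h v" \<epsilon>]
      by (simp add: vertex_defect_def weighted_degree_fun_upd[OF assms(2,3)])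
  qed
  also have "\<dots> = total_defect g f V E h + (\<Sum>v\<in>V. if v \<in> e then ?change v else 0)"
    by (simp add: sum.distrib total_defect_def)
  also have "(\<Sum>v\<in>V. if v \<in> e then ?change v else 0) = (\<Sum>v\<in>e. ?change v)"
    using assms(1,4) by (intro sum.mono_neutral_cong_right) auto
  also have "\<dots> = - 2 * \<epsilon> * (\<Sum>v\<in>e. ?y v) + card e * \<epsilon>\<^sup>2"
    by (simp only: sum.distrib sum_distrib_left sum_constant)
  finally show ?thesis by (simp only: diff_conv_add_uminus mult_minus_left add.assoc)
qed

lemma total_defect_attains_min:
  obtains h :: "'a set \<Rightarrow> real"
    where "\<And>e. h e \<in> {0..1}"
      "\<And>k. (\<And>e. k e \<in> {0..1}) \<Longrightarrow> total_defect g f V E h \<le> total_defect g f V E k"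
proof -
  define K :: "('a set \<Rightarrow> real) set" where "K = PiE UNIV (\<lambda>_. {0..1})"
  have "compactin (product_topology (\<lambda>_. euclidean) UNIV) K"
    unfolding K_def by (subst compactin_PiE) auto
  then have "compact K"
    by (simp only: euclidean_product_topology compactin_euclidean_iff)
  moreover have "K \<noteq> {}"
    unfolding K_def by (simp add: PiE_eq_empty_iff)
  moreover have "continuous_on K (total_defect g f V E)"
    unfolding total_defect_def vertex_defect_def weighted_degree_def defect_def
    by (intro continuous_intros continuous_on_product_coordinates
        continuous_on_subset[OF continuous_on_product_coordinates subset_UNIV])
  ultimately obtain h where "h \<in> K" "\<forall>k\<in>K. total_defect g f V E h \<le> total_defect g f V E k"
    using continuous_attains_inf by blast
  then show thesis
    by (intro that[of h]) (auto simp: K_def PiE_iff)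
qed

section \<open>Anstee's criterion\<close>

definition anstee_condition ::
    "('a \<Rightarrow> real) \<Rightarrow> ('a \<Rightarrow> real) \<Rightarrow> 'a set \<Rightarrow> 'a set set \<Rightarrow> bool" where
  "anstee_condition g f V E \<longleftrightarrow>
     (\<forall>S T. S \<subseteq> V \<longrightarrow> T \<subseteq> V \<longrightarrow> S \<inter> T = {} \<longrightarrow>
        sum g T \<le> sum f S + (\<Sum>v\<in>T. real (degree (edges_avoiding E S) v)))"

lemma anstee_condition_constI:
  assumes "\<And>S T. S \<subseteq> V \<Longrightarrow> T \<subseteq> V \<Longrightarrow> S \<inter> T = {} \<Longrightarrow>
      a * card T \<le> b * card S + (\<Sum>v\<in>T. degree (edges_avoiding E S) v)"
  shows "anstee_condition (\<lambda>_. real a) (\<lambda>_. real b) V E"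
  unfolding anstee_condition_def
proof (intro allI impI)
  fix S T assume "S \<subseteq> V" "T \<subseteq> V" "S \<inter> T = {}"
  then have "real (a * card T) \<le> real (b * card S + (\<Sum>v\<in>T. degree (edges_avoiding E S) v))"
    by (intro of_nat_mono assms)
  then show "(\<Sum>v\<in>T. real a) \<le> (\<Sum>v\<in>S. real b)
      + (\<Sum>v\<in>T. real (degree (edges_avoiding E S) v))"
    by (simp add: mult.commute)
qed

locale total_defect_minimiser =
  fixes V :: "'a set" and E :: "'a set set" and g f :: "'a \<Rightarrow> real" and h :: "'a set \<Rightarrow> real"
  assumes graph: "simple_graph V E"
    and lower_le_upper: "v \<in> V \<Longrightarrow> g v \<le> f v"
    and weight: "h e \<in> {0..1}"
    and minimal: "(\<And>e. k e \<in> {0..1}) \<Longrightarrow> total_defect g f V E h \<le> total_defect g f V E k"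
begin

abbreviation y :: "'a \<Rightarrow> real" where
  "y \<equiv> vertex_defect g f E h"

definition max_defect :: real where
  "max_defect = Max (insert 0 ((\<lambda>v. \<bar>y v\<bar>) ` V))"

definition max_deficient :: "'a set" where
  "max_deficient = {v \<in> V. y v = max_defect}"

definition max_excessive :: "'a set" where
  "max_excessive = {v \<in> V. y v = - max_defect}"

lemma finite_vertices: "finite V"
  using graph by (simp add: simple_graph_def)

lemma abs_defect_le_max_defect:
  assumes "v \<in> V"
  shows "\<bar>y v\<bar> \<le> max_defect"
  unfolding max_defect_def using finite_vertices assms by simp

lemma max_defect_nonneg: "0 \<le> max_defect"
  unfolding max_defect_def using finite_vertices by simp

lemma finite_max_deficient: "finite max_deficient"
  and finite_max_excessive: "finite max_excessive"
  using finite_vertices by (simp_all add: max_deficient_def max_excessive_def)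

lemma max_excessive_max_deficient_disjoint:
  assumes "max_defect > 0"
  shows "max_excessive \<inter> max_deficient = {}"
  using assms by (auto simp: max_deficient_def max_excessive_def)

lemma max_deficient_or_excessive_nonempty:
  assumes "max_defect > 0"
  shows "max_deficient \<noteq> {} \<or> max_excessive \<noteq> {}"
proof -
  have "max_defect \<in> insert 0 ((\<lambda>v. \<bar>y v\<bar>) ` V)"
    unfolding max_defect_def using finite_vertices by (intro Max_in) auto
  then obtain v where "v \<in> V" "\<bar>y v\<bar> = max_defect"
    using assms by auto
  then show ?thesis
    by (auto simp: max_deficient_def max_excessive_def abs_if split: if_splits)
qed

lemma variational_inequality:
  assumes "e \<in> E" "t \<in> {0..1}"
  shows "(t - h e) * (\<Sum>v\<in>e. y v) \<le> 0"
proof (rule dense_ge_bounded[of 0 1])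
  fix \<theta> :: real assume \<theta>: "0 < \<theta>" "\<theta> < 1"
  define \<epsilon> where "\<epsilon> = \<theta> * (t - h e)"
  have e: "e \<subseteq> V" "card e = 2"
    using graph assms(1) by (auto simp: simple_graph_def nsets_def)
  have "h e + \<epsilon> = (1 - \<theta>) * h e + \<theta> * t"
    by (simp add: \<epsilon>_def algebra_simps)
  also have "\<dots> \<in> {0..1}"
    using weight[of e] assms(2) \<theta> convex_bound_le[of "h e" 1 t "1 - \<theta>" \<theta>] by simp
  finally have "total_defect g f V E h \<le> total_defect g f V E (h(e := h e + \<epsilon>))"
    using weight by (intro minimal) auto
  also have "\<dots> \<le> total_defect g f V E h - 2 * \<epsilon> * (\<Sum>v\<in>e. y v) + card e * \<epsilon>\<^sup>2"
    using assms(1) e finite_vertices simple_graph_finite_edges[OF graph] lower_le_upper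
    by (intro total_defect_fun_upd_le) auto
  finally have "\<epsilon> * (\<Sum>v\<in>e. y v) \<le> \<epsilon>\<^sup>2"
    using e by simp
  then have "\<theta> * ((t - h e) * (\<Sum>v\<in>e. y v)) \<le> \<theta> * (\<theta> * (t - h e)\<^sup>2)"
    by (simp only: \<epsilon>_def power2_eq_square mult_ac)
  then have "(t - h e) * (\<Sum>v\<in>e. y v) \<le> \<theta> * (t - h e)\<^sup>2"
    using \<theta> by simp
  also have "\<dots> \<le> \<theta>"
    using weight[of e] assms(2) \<theta> by (simp add: mult_left_le abs_square_le_1 abs_le_iff)
  finally show "(t - h e) * (\<Sum>v\<in>e. y v) \<le> \<theta>" .
qed simp

lemma weight_eq_1_if_max_deficient:
  assumes "e \<in> E" "e \<inter> max_deficient \<noteq> {}" "e \<inter> max_excessive = {}"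
  shows "h e = 1"
proof -
  obtain u w where "e = {u, w}" "u \<noteq> w" "u \<in> V" "w \<in> V"
    using simple_graph_edgeE[OF graph assms(1)] by blast
  then have "(\<Sum>v\<in>e. y v) > 0"
    using assms(2,3) abs_defect_le_max_defect[of u] abs_defect_le_max_defect[of w]
    by (auto simp: max_deficient_def max_excessive_def)
  then have "1 \<le> h e"
    using variational_inequality[OF assms(1), of 1] by (simp add: mult_le_0_iff)
  then show ?thesis using weight[of e] by simp
qed

lemma weight_eq_0_if_max_excessive:
  assumes "e \<in> E" "e \<inter> max_excessive \<noteq> {}" "e \<inter> max_deficient = {}"
  shows "h e = 0"
proof -
  obtain u w where "e = {u, w}" "u \<noteq> w" "u \<in> V" "w \<in> V"
    using simple_graph_edgeE[OF graph assms(1)] by blast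
  then have "(\<Sum>v\<in>e. y v) < 0"
    using assms(2,3) abs_defect_le_max_defect[of u] abs_defect_le_max_defect[of w]
    by (auto simp: max_deficient_def max_excessive_def)
  then have "h e \<le> 0"
    using variational_inequality[OF assms(1), of 0] by (simp add: zero_le_mult_iff)
  then show ?thesis using weight[of e] by simp
qed

lemma edge_weight_balance:
  assumes "e \<in> E" "max_defect > 0"
  shows "real (card (e \<inter> max_deficient)) * h e - real (card (e \<inter> max_excessive)) * h e
    = (if e \<inter> max_excessive = {} then real (card (e \<inter> max_deficient)) else 0)"
proof -
  have "card (e \<inter> max_excessive) = card (e \<inter> max_deficient)"
    if "e \<inter> max_excessive \<noteq> {}" "e \<inter> max_deficient \<noteq> {}"
  proof -
    obtain u w where "e = {u, w}"
      using simple_graph_edgeE[OF graph assms(1)] by blast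
    then have "(e \<inter> max_excessive = {u} \<and> e \<inter> max_deficient = {w})
        \<or> (e \<inter> max_excessive = {w} \<and> e \<inter> max_deficient = {u})"
      using that max_excessive_max_deficient_disjoint[OF assms(2)] by auto
    then show ?thesis by auto
  qed
  with weight_eq_1_if_max_deficient[OF assms(1)] weight_eq_0_if_max_excessive[OF assms(1)] show ?thesis
    by (cases "e \<inter> max_excessive = {}"; cases "e \<inter> max_deficient = {}") auto
qed

lemma weighted_degree_max_deficient:
  assumes "max_defect > 0" "v \<in> max_deficient"
  shows "weighted_degree E h v = g v - max_defect"
  using assms defect_pos_eq[of "g v" "f v" "weighted_degree E h v"]
  by (simp add: max_deficient_def vertex_defect_def)

lemma weighted_degree_max_excessive:
  assumes "max_defect > 0" "v \<in> max_excessive"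
  shows "weighted_degree E h v = f v + max_defect"
  using assms defect_neg_eq[of "g v" "f v" "weighted_degree E h v"] lower_le_upper[of v]
  by (simp add: max_excessive_def vertex_defect_def)

lemma sum_degree_avoiding_max_excessive:
  assumes "max_defect > 0"
  shows "(\<Sum>v\<in>max_deficient. real (degree (edges_avoiding E max_excessive) v))
    = sum g max_deficient - sum f max_excessive
      - max_defect * (card max_deficient + card max_excessive)"
proof -
  have finE: "finite E" using graph by (rule simple_graph_finite_edges)
  have "(\<Sum>v\<in>max_deficient. real (degree (edges_avoiding E max_excessive) v))
      = (\<Sum>e | e \<in> E \<and> e \<inter> max_excessive = {}. real (card (e \<inter> max_deficient)))"
    using sum_degree[OF finite_max_deficient, of "edges_avoiding E max_excessive"] finE
    by (simp add: edges_avoiding_def flip: of_nat_sum)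
  also have "\<dots> = (\<Sum>e\<in>E. if e \<inter> max_excessive = {} then real (card (e \<inter> max_deficient)) else 0)"
    using finE by (simp add: sum.inter_filter)
  also have "\<dots> = (\<Sum>e\<in>E. real (card (e \<inter> max_deficient)) * h e
      - real (card (e \<inter> max_excessive)) * h e)"
    using edge_weight_balance assms by (intro sum.cong) auto
  also have "\<dots> = (\<Sum>v\<in>max_deficient. weighted_degree E h v)
      - (\<Sum>v\<in>max_excessive. weighted_degree E h v)"
    using finE finite_max_deficient finite_max_excessive
    by (simp add: sum_weighted_degree sum_subtractf)
  also have "\<dots> = (\<Sum>v\<in>max_deficient. g v - max_defect) - (\<Sum>v\<in>max_excessive. f v + max_defect)"
    using weighted_degree_max_deficient weighted_degree_max_excessive assms by simp
  also have "\<dots> = sum g max_deficient - sum f max_excessive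
      - max_defect * (card max_deficient + card max_excessive)"
    by (simp add: sum_subtractf sum.distrib algebra_simps)
  finally show ?thesis .
qed

lemma max_defect_eq_0:
  assumes "anstee_condition g f V E"
  shows "max_defect = 0"
proof (rule ccontr)
  assume "max_defect \<noteq> 0"
  then have pos: "max_defect > 0" using max_defect_nonneg by simp
  have "max_excessive \<subseteq> V" "max_deficient \<subseteq> V"
    by (auto simp: max_excessive_def max_deficient_def)
  then have "sum g max_deficient \<le> sum f max_excessive
      + (\<Sum>v\<in>max_deficient. real (degree (edges_avoiding E max_excessive) v))"
    using assms max_excessive_max_deficient_disjoint[OF pos] unfolding anstee_condition_def by blast
  then have "max_defect * (card max_deficient + card max_excessive) \<le> 0"
    using sum_degree_avoiding_max_excessive[OF pos] by simp
  then have "card max_deficient + card max_excessive = 0"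
    using pos by (simp add: mult_le_0_iff flip: of_nat_add)
  then show False
    using max_deficient_or_excessive_nonempty[OF pos] finite_max_deficient finite_max_excessive
    by simp
qed

lemma weighted_degree_in_bounds:
  assumes "anstee_condition g f V E" "v \<in> V"
  shows "weighted_degree E h v \<in> {g v..f v}"
proof -
  have "y v = 0"
    using abs_defect_le_max_defect[OF assms(2)] max_defect_eq_0[OF assms(1)] by simp
  then show ?thesis
    using defect_eq_0_iff[OF lower_le_upper[OF assms(2)]] by (simp add: vertex_defect_def)
qed

end

lemma ex_weighted_degree_in_bounds:
  assumes "simple_graph V E" "\<And>v. v \<in> V \<Longrightarrow> g v \<le> f v" "anstee_condition g f V E"
  obtains h :: "'a set \<Rightarrow> real"
    where "\<And>e. h e \<in> {0..1}" "\<And>v. v \<in> V \<Longrightarrow> weighted_degree E h v \<in> {g v..f v}"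
proof -
  obtain h :: "'a set \<Rightarrow> real" where "\<And>e. h e \<in> {0..1}"
      "\<And>k. (\<And>e. k e \<in> {0..1}) \<Longrightarrow> total_defect g f V E h \<le> total_defect g f V E k"
    using total_defect_attains_min[of g f V E] by blast
  then interpret total_defect_minimiser V E g f h
    using assms(1,2) by unfold_locales blast+
  show thesis
    using that weight weighted_degree_in_bounds[OF assms(3)] by blast
qed

lemma fractional_factor_if_anstee:
  assumes "simple_graph V E" "a \<le> b" "anstee_condition (\<lambda>_. real a) (\<lambda>_. real b) V E"
  shows "\<exists>F. fractional_factor a b V E F"
proof -
  obtain h :: "'a set \<Rightarrow> real" where "\<And>e. h e \<in> {0..1}"
      "\<And>v. v \<in> V \<Longrightarrow> weighted_degree E h v \<in> {real a..real b}"
    using ex_weighted_degree_in_bounds[OF assms(1) _ assms(3)] assms(2) by auto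
  then have "fractional_factor a b V E {e \<in> E. h e > 0}"
    unfolding fractional_factor_def weighted_degree_def by auto
  then show ?thesis by blast
qed

section \<open>Graphs with few non-edges\<close>

text \<open>With \<open>s = \<bar>S\<bar>\<close> and \<open>t = \<bar>T\<bar>\<close>, the number \<open>D\<close> stands for the degree sum over \<open>T\<close> in \<open>G - S\<close>
  and \<open>M\<close> for the number of non-edges of \<open>G\<close>.\<close>

lemma anstee_bound_if_few_nonedges:
  fixes a b n s t D M :: int
  assumes "a \<le> b" "3 \<le> b" "7 \<le> n" "2 \<le> s" "s + t \<le> n"
    and degrees: "a * t \<le> D + s * t"
    and nonedges: "n * t \<le> D + 2 * M + s * t + t" "2 * M + a + 2 \<le> 2 * n"
  shows "a * t \<le> b * s + D"
proof (rule ccontr)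
  assume "\<not> ?thesis"
  then have violation: "b * s + D < a * t" by simp
  then have "s * b < s * t"
    using degrees by (simp add: algebra_simps)
  then have t_gt: "b < t"
    using \<open>2 \<le> s\<close> by (simp add: mult_less_cancel_left)
  define k where "k = n - 1 - s - a"
  have k_nonneg: "0 \<le> k"
    using assms(1,5) t_gt unfolding k_def by linarith
  have "t * k + b * s < 2 * M"
    using violation nonedges(1) unfolding k_def by (simp add: algebra_simps)
  also have "\<dots> \<le> 2 * k + 2 * s + a"
    using nonedges(2) unfolding k_def by simp
  finally have lt_a: "(t - 2) * k + (b - 2) * s < a"
    by (simp add: algebra_simps)
  have "2 * k \<le> (t - 2) * k" "(b - 2) * 2 \<le> (b - 2) * s"
    using t_gt k_nonneg \<open>3 \<le> b\<close> \<open>2 \<le> s\<close> by (intro mult_right_mono mult_left_mono; simp)+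
  then have "2 * k + (b - 2) * 2 < a"
    using lt_a by linarith
  then have tight: "k = 0" "b = 3" "a = 3"
    using assms(1,2) k_nonneg by auto
  then have "s < 3"
    using lt_a by simp
  then show False
    using tight \<open>7 \<le> n\<close> unfolding k_def by simp
qed

text \<open>The slack \<open>2\<close> in the degree sums is what the deletion of one edge can cost.\<close>

lemma anstee_condition_if_few_nonedges:
  fixes a b :: nat
  assumes graph: "simple_graph V E" and "a \<le> b" "3 \<le> b" "7 \<le> card V"
    and degree_ge: "\<And>v. v \<in> V \<Longrightarrow> a \<le> degree E v"
    and degree_sums: "\<And>T. T \<subseteq> V \<Longrightarrow> (a + 1) * card T \<le> (\<Sum>v\<in>T. degree E v) + 2"
    and nonedges: "2 * card (complement_edges V E) + a + 2 \<le> 2 * card V"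
  shows "anstee_condition (\<lambda>_. real a) (\<lambda>_. real b) V E"
proof (rule anstee_condition_constI)
  fix S T assume ST: "S \<subseteq> V" "T \<subseteq> V" "S \<inter> T = {}"
  define D where "D = (\<Sum>v\<in>T. degree (edges_avoiding E S) v)"
  have finV: "finite V" using graph by (simp add: simple_graph_def)
  then have fin: "finite S" "finite T" using ST finite_subset by blast+
  have sum_le: "(\<Sum>v\<in>T. degree E v) \<le> D + card S * card T"
    unfolding D_def using sum_degree_le_sum_degree_avoiding[OF graph fin(1) ST(3)] .
  have "a * card T \<le> (\<Sum>v\<in>T. degree E v)"
    using sum_mono[of T "\<lambda>_. a" "degree E"] degree_ge ST(2) by (simp add: subset_iff mult.commute)
  with sum_le have degrees: "a * card T \<le> D + card S * card T" by simp
  consider (empty) "card S = 0" | (singleton) "card S = 1" | (large) "2 \<le> card S" by linarith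
  then have "a * card T \<le> b * card S + D"
  proof cases
    case empty
    then show ?thesis using degrees by simp
  next
    case singleton
    then show ?thesis using degree_sums[OF ST(2)] sum_le \<open>3 \<le> b\<close> by simp
  next
    case large
    have "card S + card T \<le> card V"
      using card_mono[OF finV, of "S \<union> T"] ST fin by (simp add: card_Un_disjoint)
    moreover have "card V * card T \<le> D + 2 * card (complement_edges V E) + card S * card T + card T"
      using card_mult_card_le_sum_degree_complement[OF graph ST(2)] sum_le by simp
    ultimately have "int a * int (card T) \<le> int b * int (card S) + int D"
      using large \<open>a \<le> b\<close> \<open>3 \<le> b\<close> \<open>7 \<le> card V\<close> degrees nonedges
      by (intro anstee_bound_if_few_nonedges[where n = "card V" and M = "card (complement_edges V E)"])
        (simp_all flip: of_nat_mult of_nat_add)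
    then show ?thesis by (simp flip: of_nat_mult of_nat_add)
  qed
  then show "a * card T \<le> b * card S + (\<Sum>v\<in>T. degree (edges_avoiding E S) v)"
    unfolding D_def .
qed

section \<open>Deleting an edge\<close>

lemma min_degree_le_degree:
  assumes "finite V" "v \<in> V"
  shows "min_degree V E \<le> degree E v"
  using assms by (simp add: min_degree_def)

lemma degree_le_Suc_degree_delete_edge:
  assumes "finite E" "e \<in> E"
  shows "degree E v \<le> Suc (degree (E - {e}) v)"
  using degree_delete_edge[OF assms, of v] degree_le_card[of "{e}" v] by simp

lemma sum_degree_le_sum_degree_delete_edge:
  assumes "simple_graph V E" "e \<in> E" "finite T"
  shows "(\<Sum>v\<in>T. degree E v) \<le> (\<Sum>v\<in>T. degree (E - {e}) v) + 2"
proof -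
  have "(\<Sum>v\<in>T. degree E v) = (\<Sum>v\<in>T. degree (E - {e}) v) + (\<Sum>v\<in>T. degree {e} v)"
    using degree_delete_edge[OF simple_graph_finite_edges[OF assms(1)] assms(2)]
    by (simp add: sum.distrib)
  moreover have "(\<Sum>v\<in>T. degree {e} v) \<le> 2"
    using sum_degree_le[OF simple_graph_subset[OF assms(1), of "{e}"] assms(3)] assms(2) by simp
  ultimately show ?thesis by simp
qed

lemma card_complement_edges_delete_edge:
  assumes "simple_graph V E" "e \<in> E"
  shows "card (complement_edges V (E - {e})) + card E = ((card V - 1) choose 2) + card V"
proof -
  have "card V > 0"
    using assms simple_graph_edgeE[OF assms] by (auto simp: simple_graph_def card_gt_0_iff)
  then have "card V choose 2 = ((card V - 1) choose 2) + (card V - 1)"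
    by (simp add: choose_reduce_nat)
  moreover have "card E = Suc (card (E - {e}))"
    using simple_graph_finite_edges[OF assms(1)] assms(2) by (rule card.remove)
  ultimately show ?thesis
    using card_complement_edges[OF simple_graph_subset[OF assms(1)], of "E - {e}"] \<open>card V > 0\<close>
    by simp
qed

lemma card_complement_edges_delete_edge_le:
  assumes "simple_graph V E" "e \<in> E"
    and "real ((card V - 1) choose 2) + (real a + 2) / 2 \<le> real (card E)"
  shows "2 * card (complement_edges V (E - {e})) + a + 2 \<le> 2 * card V"
proof -
  have "real (card (complement_edges V (E - {e}))) + real (card E)
      = real ((card V - 1) choose 2) + real (card V)"
    using card_complement_edges_delete_edge[OF assms(1,2)] by (simp flip: of_nat_add)
  then have "real (2 * card (complement_edges V (E - {e})) + a + 2) \<le> real (2 * card V)"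
    using assms(3) by (simp add: field_simps)
  then show ?thesis
    unfolding of_nat_le_iff .
qed

theorem theorem1p8:
  fixes V :: "'a set" and E :: "'a set set" and a b n :: nat
  assumes "1 \<le> a"
    and "b \<ge> max a 3"
    and "simple_graph V E"
    and "card V = n"
    and "n \<ge> max (a + 2) 7"
    and "min_degree V E \<ge> a + 1"
    and "real (card E) \<ge> real ((n - 1) choose 2) + (real a + 2) / 2"
  shows "fractional_deleted_graph a b V E"
  unfolding fractional_deleted_graph_def
proof
  fix e assume "e \<in> E"
  have fin: "finite V" "finite E"
    using assms(3) simple_graph_finite_edges by (auto simp: simple_graph_def)
  have graph: "simple_graph V (E - {e})"
    using simple_graph_subset[OF assms(3)] by blast
  have degree: "a + 1 \<le> degree E v" if "v \<in> V" for v
    using min_degree_le_degree[OF fin(1) that, of E] assms(6) by simp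
  have "anstee_condition (\<lambda>_. real a) (\<lambda>_. real b) V (E - {e})"
  proof (rule anstee_condition_if_few_nonedges[OF graph])
    show "a \<le> degree (E - {e}) v" if "v \<in> V" for v
      using degree[OF that] degree_le_Suc_degree_delete_edge[OF fin(2) \<open>e \<in> E\<close>, of v] by simp
    show "(a + 1) * card T \<le> (\<Sum>v\<in>T. degree (E - {e}) v) + 2" if "T \<subseteq> V" for T
      using sum_bounded_below[of T "a + 1" "degree E"] degree that finite_subset[OF that fin(1)]
        sum_degree_le_sum_degree_delete_edge[OF assms(3) \<open>e \<in> E\<close>, of T]
      by (auto simp: subset_iff mult.commute)
    show "2 * card (complement_edges V (E - {e})) + a + 2 \<le> 2 * card V"
      using card_complement_edges_delete_edge_le[OF assms(3) \<open>e \<in> E\<close>] assms(4,7) by simp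
  qed (use assms in auto)
  then show "\<exists>F. fractional_factor a b V (E - {e}) F"
    using fractional_factor_if_anstee[OF graph] assms(2) by simp
qed

end
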